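(* Let $\nu$ be a positive Borel measure on $\mathbb{R}^d$ with $\int(1\wedge|x|)\,\nu(\mathrm{d}x)<\infty$ and $\nu(\{0\})=0$. For every $u\in\mathrm{BV}(\mathbb{R}^d)$: (i) $\mathcal{F}_\nu(u)\le C_\nu\|u\|_{\mathrm{BV}}$, where $C_\nu=\int(1\wedge|x|)\,\nu(\mathrm{d}x)$; (ii) $\mathcal{F}_\nu(u)\le\tilde C_\nu\int_{\mathbb{R}^d}|Du|$, where $\tilde C_\nu=\int|x|\,\nu(\mathrm{d}x)\le\infty$.
   Context: $a\wedge b=\min(a,b)$. $\mathcal{F}_\nu(u)=\frac12\int_{\mathbb{R}^d}\int_{\mathbb{R}^d}|u(x+y)-u(y)|\,\nu(\mathrm{d}x)\,\mathrm{d}y$. $\mathrm{BV}(\mathbb{R}^d)$ is the space of $u\in L^1(\mathbb{R}^d)$ whose distributional gradient $Du$ is an $\mathbb{R}^d$-valued Radon measure with finite total variation; $\int_{\mathbb{R}^d}|Du|=|Du|(\mathbb{R}^d)$ and $\|u\|_{\mathrm{BV}}=\|u\|_{L^1}+|Du|(\mathbb{R}^d)$. *)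

theory Defs
  imports "HOL-Analysis.Analysis"
begin

primrec C_k :: "nat \<Rightarrow> ('a::euclidean_space \<Rightarrow> real) \<Rightarrow> bool" where
  "C_k 0 f \<longleftrightarrow> continuous_on UNIV f"
| "C_k (Suc k) f \<longleftrightarrow> (\<forall>x. f differentiable (at x)) \<and>
     (\<forall>b\<in>Basis. C_k k (\<lambda>x. frechet_derivative f (at x) b))"

definition test_functions :: "('a::euclidean_space \<Rightarrow> real) set" where
  "test_functions = {\<phi>. (\<forall>k. C_k k \<phi>) \<and> compact (closure {x. \<phi> x \<noteq> 0})}"

text \<open>
  A vector measure is a set function whose values outside the Borel sets are irrelevant.
  On Euclidean space a countably additive Borel set function with values in a
  finite-dimensional space is automatically Radon.
\<close>

definition vector_measure ::
    "('a::euclidean_space set \<Rightarrow> 'b::euclidean_space) \<Rightarrow> bool" where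
  "vector_measure \<mu> \<longleftrightarrow>
     (\<forall>A :: nat \<Rightarrow> 'a set. range A \<subseteq> sets borel \<longrightarrow> disjoint_family A \<longrightarrow>
        (\<lambda>n. \<mu> (A n)) sums \<mu> (\<Union>n. A n))"

definition total_variation ::
    "('a::euclidean_space set \<Rightarrow> 'b::euclidean_space) \<Rightarrow> 'a set \<Rightarrow> ennreal" where
  "total_variation \<mu> E =
     (SUP A \<in> {A :: nat \<Rightarrow> 'a set. range A \<subseteq> sets borel \<and> disjoint_family A \<and> (\<Union>n. A n) = E}.
        (\<Sum>n. ennreal (norm (\<mu> (A n)))))"

text \<open>
  The positive part of the Jordan decomposition of a real-valued signed measure; the
  negative part is the positive part of the negated set function. In the supremum
  \<open>ennreal\<close> truncates negative values at \<open>0\<close>, which is harmless since \<open>B = {}\<close> contributes \<open>0\<close>.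
\<close>

definition positive_part :: "('a::euclidean_space set \<Rightarrow> real) \<Rightarrow> 'a measure" where
  "positive_part m =
     measure_of UNIV (sets borel) (\<lambda>A. SUP B \<in> {B \<in> sets borel. B \<subseteq> A}. ennreal (m B))"

definition signed_integral ::
    "('a::euclidean_space set \<Rightarrow> real) \<Rightarrow> ('a \<Rightarrow> real) \<Rightarrow> real" where
  "signed_integral m f =
     (\<integral>x. f x \<partial>positive_part m) - (\<integral>x. f x \<partial>positive_part (\<lambda>A. - m A))"

definition is_gradient_measure ::
    "('a::euclidean_space \<Rightarrow> real) \<Rightarrow> ('a set \<Rightarrow> 'a) \<Rightarrow> bool" where
  "is_gradient_measure u \<mu> \<longleftrightarrow>
     vector_measure \<mu> \<and> total_variation \<mu> UNIV < \<infinity> \<and>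
     (\<forall>\<phi>\<in>test_functions. \<forall>b\<in>Basis.
        (\<integral>x. u x * frechet_derivative \<phi> (at x) b \<partial>lborel)
          = - signed_integral (\<lambda>A. \<mu> A \<bullet> b) \<phi>)"

text \<open>Elements of \<open>L\<^sup>1\<close> are represented by Borel measurable integrable functions.\<close>

definition BV :: "('a::euclidean_space \<Rightarrow> real) set" where
  "BV = {u. integrable lborel u \<and> (\<exists>\<mu>. is_gradient_measure u \<mu>)}"

text \<open>The gradient measure is unique on Borel sets, and only those enter the total variation.\<close>

definition Grad :: "('a::euclidean_space \<Rightarrow> real) \<Rightarrow> 'a set \<Rightarrow> 'a" where
  "Grad u = (SOME \<mu>. is_gradient_measure u \<mu>)"

definition BV_norm :: "('a::euclidean_space \<Rightarrow> real) \<Rightarrow> ennreal" where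
  "BV_norm u = (\<integral>\<^sup>+x. ennreal \<bar>u x\<bar> \<partial>lborel) + total_variation (Grad u) UNIV"

definition nonlocal_energy ::
    "'a::euclidean_space measure \<Rightarrow> ('a \<Rightarrow> real) \<Rightarrow> ennreal" where
  "nonlocal_energy \<nu> u =
     ennreal (1/2) * (\<integral>\<^sup>+y. (\<integral>\<^sup>+x. ennreal \<bar>u (x + y) - u y\<bar> \<partial>\<nu>) \<partial>lborel)"

end

theory Submission
  imports Defs
begin

text \<open>
  Everything rests on the translation estimate \<open>\<integral>|u(h + y) - u(y)| dy \<le> |h| |Du|(\<real>\<^sup>d)\<close>, which is
  proved by duality. For a test function \<open>\<phi>\<close> with \<open>|\<phi>| \<le> 1\<close>, the average
  \<open>\<psi>(x) = \<integral>\<^sub>0\<^sup>1 \<phi>(x - th) dt\<close> is again a test function bounded by \<open>1\<close>, and its derivative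
  along \<open>h\<close> is \<open>\<phi>(x) - \<phi>(x - h)\<close>. Hence \<open>\<integral>(u(h + y) - u(y)) \<phi>(y) dy = -\<integral>u \<partial>\<^sub>h\<psi>\<close> equals
  \<open>\<integral>\<psi> d(h \<bullet> Du)\<close>, which is at most \<open>|h| |Du|(\<real>\<^sup>d)\<close>. Letting \<open>\<phi>\<close> run through
  test functions that converge almost everywhere to the sign of the difference (a polynomial from
  Stone-Weierstrass times a smooth cutoff) gives the estimate. Integrating it against \<open>\<nu>\<close> with
  Tonelli's theorem yields (ii); (i) follows in the same way, using the trivial bound
  \<open>2 \<parallel>u\<parallel>\<close> of the \<open>L\<^sup>1\<close> norm of the difference where \<open>|h| > 1\<close>.
\<close>

section \<open>Integration against a vector measure\<close>

lemma vector_measure_sums: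
  assumes "vector_measure \<mu>" "\<And>i::nat. A i \<in> sets borel" "disjoint_family A"
  shows "(\<lambda>i. \<mu> (A i)) sums \<mu> (\<Union>i. A i)"
  using assms by (auto simp: vector_measure_def image_subset_iff)

lemma vector_measure_empty:
  assumes "vector_measure \<mu>"
  shows "\<mu> {} = 0"
proof -
  have "(\<lambda>n::nat. \<mu> {}) sums \<mu> (\<Union>n::nat. {})"
    using assms by (intro vector_measure_sums) (auto simp: disjoint_family_on_def)
  then have "(\<lambda>n::nat. \<mu> {}) \<longlonglongrightarrow> 0"
    using summable_LIMSEQ_zero sums_summable by blast
  then show ?thesis
    by (simp add: LIMSEQ_const_iff)
qed

lemma vector_measure_finite_sum:
  assumes \<mu>: "vector_measure \<mu>"
    and A: "\<And>i. i < (n::nat) \<Longrightarrow> A i \<in> sets borel" "disjoint_family_on A {..<n}"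
  shows "\<mu> (\<Union>i<n. A i) = (\<Sum>i<n. \<mu> (A i))"
proof -
  let ?B = "\<lambda>i. if i < n then A i else {}"
  have eq: "(\<Union>i. ?B i) = (\<Union>i<n. A i)"
    by (auto split: if_splits)
  have "(\<lambda>i. \<mu> (?B i)) sums \<mu> (\<Union>i. ?B i)"
    using A by (intro vector_measure_sums[OF \<mu>]) (auto simp: disjoint_family_on_def)
  from this[unfolded eq] have "\<mu> (\<Union>i<n. A i) = (\<Sum>i<n. \<mu> (?B i))"
    by (rule sums_unique2[OF _ sums_finite]) (auto simp: vector_measure_empty[OF \<mu>])
  then show ?thesis
    by simp
qed

lemma vector_measure_Un:
  assumes "vector_measure \<mu>" "A \<in> sets borel" "B \<in> sets borel" "A \<inter> B = {}"
  shows "\<mu> (A \<union> B) = \<mu> A + \<mu> B"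
proof -
  have "\<mu> (\<Union>i<2. if i = (0::nat) then A else B) = (\<Sum>i<2. \<mu> (if i = (0::nat) then A else B))"
    using assms by (intro vector_measure_finite_sum) (auto simp: disjoint_family_on_def)
  moreover have "(\<Union>i<2. if i = (0::nat) then A else B) = A \<union> B"
    by (auto simp: numeral_2_eq_2 lessThan_Suc)
  ultimately show ?thesis
    by (simp add: numeral_2_eq_2)
qed

lemma vector_measure_Diff:
  assumes "vector_measure \<mu>" "A \<in> sets borel" "B \<in> sets borel" "B \<subseteq> A"
  shows "\<mu> (A - B) = \<mu> A - \<mu> B"
proof -
  have "\<mu> (B \<union> (A - B)) = \<mu> B + \<mu> (A - B)"
    using assms by (intro vector_measure_Un) auto
  moreover have "B \<union> (A - B) = A"
    using assms by auto
  ultimately show ?thesis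
    by simp
qed

lemma vector_measure_inner:
  assumes "vector_measure \<mu>"
  shows "vector_measure (\<lambda>A. \<mu> A \<bullet> b)"
  unfolding vector_measure_def
  using assms[unfolded vector_measure_def] bounded_linear.sums[OF bounded_linear_inner_left]
  by metis

lemma vector_measure_uminus:
  assumes "vector_measure \<mu>"
  shows "vector_measure (\<lambda>A. - \<mu> A)"
  using assms unfolding vector_measure_def by (metis sums_minus)

lemma sum_norm_le_total_variation:
  fixes \<mu> :: "'a::euclidean_space set \<Rightarrow> 'b::euclidean_space"
  assumes \<mu>: "vector_measure \<mu>"
    and A: "\<And>i. i < (n::nat) \<Longrightarrow> A i \<in> sets borel" "disjoint_family_on A {..<n}"
  shows "ennreal (\<Sum>i<n. norm (\<mu> (A i))) \<le> total_variation \<mu> UNIV"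
proof -
  \<comment> \<open>\<open>total_variation\<close> ranges over countable partitions of the whole
    space only, so slot \<open>n\<close> takes the complement of the finite family and later slots
    are empty.\<close>
  let ?B = "\<lambda>i. if i < n then A i else if i = n then UNIV - (\<Union>i<n. A i) else {}"
  have "(\<Sum>n. ennreal (norm (\<mu> (?B n)))) \<le> total_variation \<mu> UNIV"
    unfolding total_variation_def
  proof (rule SUP_upper, safe)
    show "x \<in> (\<Union>i. ?B i)" for x
      by (cases "x \<in> (\<Union>i<n. A i)") (force split: if_splits)+
    show "?B i \<in> sets borel" for i
      using A by auto
    show "disjoint_family ?B"
      using A by (auto simp: disjoint_family_on_def split: if_splits)
  qed auto
  moreover have "(\<Sum>i<n. ennreal (norm (\<mu> (?B i)))) \<le> (\<Sum>n. ennreal (norm (\<mu> (?B n))))"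
    by (rule sum_le_suminf) auto
  ultimately show ?thesis
    by simp
qed

lemma norm_le_total_variation:
  assumes "vector_measure \<mu>" "A \<in> sets borel"
  shows "ennreal (norm (\<mu> A)) \<le> total_variation \<mu> UNIV"
  using sum_norm_le_total_variation[OF assms(1), of 1 "\<lambda>_. A"] assms(2)
  by (simp add: disjoint_family_on_def)

section \<open>Positive parts and the Jordan decomposition\<close>

lemma sets_positive_part [simp, measurable_cong]: "sets (positive_part m) = sets borel"
  using sets.sigma_sets_eq[of "borel :: 'a measure"] unfolding positive_part_def by simp

lemma space_positive_part [simp]: "space (positive_part m) = UNIV"
  unfolding positive_part_def by simp

text \<open>\<open>measure_of\<close> returns the prescribed set function only if it is countably
  additive. One inequality follows from superadditivity on disjoint sets, monotonicity and a limit
  of partial sums; the other from cutting a competitor \<open>B\<close> along the sets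
  \<open>A i\<close>.\<close>

lemma emeasure_positive_part:
  fixes m :: "'a::euclidean_space set \<Rightarrow> real"
  assumes m: "vector_measure m" and A: "A \<in> sets borel"
  shows "emeasure (positive_part m) A = (SUP B \<in> {B \<in> sets borel. B \<subseteq> A}. ennreal (m B))"
proof -
  define p where "p A = (SUP B \<in> {B \<in> sets borel. B \<subseteq> A}. ennreal (m B))" for A
  have upper: "ennreal (m B) \<le> p A" if "B \<in> sets borel" "B \<subseteq> A" for A B
    unfolding p_def using that by (intro SUP_upper) auto
  have mono: "p A \<le> p B" if "A \<subseteq> B" for A B
    unfolding p_def using that by (intro SUP_subset_mono) auto
  have superadd: "p A + p B \<le> p (A \<union> B)" if "A \<inter> B = {}" for A B
  proof -
    have *: "ennreal (m A') + ennreal (m B') \<le> p (A \<union> B)"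
      if "A' \<in> sets borel" "A' \<subseteq> A" "B' \<in> sets borel" "B' \<subseteq> B" for A' B'
    proof (cases "0 \<le> m A' \<and> 0 \<le> m B'")
      case True
      then have "ennreal (m A') + ennreal (m B') = ennreal (m (A' \<union> B'))"
        using that \<open>A \<inter> B = {}\<close> by (subst vector_measure_Un[OF m]) auto
      then show ?thesis
        using that by (auto intro!: upper)
    next
      \<comment> \<open>A negative value is truncated to \<open>0\<close>, and the other set alone
        already competes in the supremum for \<open>A \<union> B\<close>.\<close>
      case False
      then have "ennreal (m A') = 0 \<or> ennreal (m B') = 0"
        by (auto simp: ennreal_eq_0_iff)
      moreover have "ennreal (m A') \<le> p (A \<union> B)" "ennreal (m B') \<le> p (A \<union> B)"
        using that by (auto intro!: upper)
      ultimately show ?thesis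
        by auto
    qed
    have ne: "{B \<in> sets borel. B \<subseteq> A} \<noteq> {}" for A :: "'a set"
      by auto
    have "ennreal (m A') + p B \<le> p (A \<union> B)" if "A' \<in> sets borel" "A' \<subseteq> A" for A'
      unfolding p_def[of B] ennreal_SUP_add_right[OF ne]
      using * that by (intro SUP_least) auto
    then show ?thesis
      unfolding p_def[of A] ennreal_SUP_add_left[OF ne, symmetric] by (intro SUP_least) auto
  qed
  have "countably_additive (sets borel) p"
  proof (rule countably_additiveI)
    fix A :: "nat \<Rightarrow> 'a set"
    assume A: "range A \<subseteq> sets borel" "disjoint_family A" "(\<Union>i. A i) \<in> sets borel"
    have "(\<Sum>i. p (A i)) \<le> p (\<Union>i. A i)"
    proof -
      have "(\<Sum>i<n. p (A i)) \<le> p (\<Union>i<n. A i)" for n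
      proof (induction n)
        case (Suc n)
        have "(\<Sum>i<Suc n. p (A i)) \<le> p (\<Union>i<n. A i) + p (A n)"
          using Suc by (simp add: add_right_mono)
        also have "\<dots> \<le> p ((\<Union>i<n. A i) \<union> A n)"
        proof (rule superadd)
          have "A i \<inter> A n = {}" if "i < n" for i
            using A(2) that by (simp add: disjoint_family_on_def)
          then show "(\<Union>i<n. A i) \<inter> A n = {}"
            by blast
        qed
        also have "(\<Union>i<n. A i) \<union> A n = (\<Union>i<Suc n. A i)"
          by (auto simp: lessThan_Suc)
        finally show ?case .
      qed simp
      also have "p (\<Union>i<n. A i) \<le> p (\<Union>i. A i)" for n
        by (intro mono) auto
      finally show ?thesis
        by (simp add: suminf_eq_SUP SUP_least)
    qed
    moreover have "p (\<Union>i. A i) \<le> (\<Sum>i. p (A i))"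
      unfolding p_def[of "\<Union>i. A i"]
    proof (rule SUP_least, safe)
      fix B assume B: "B \<in> sets borel" "B \<subseteq> (\<Union>i. A i)"
      have "(\<lambda>i. m (B \<inter> A i)) sums m (\<Union>i. B \<inter> A i)"
        using A B by (intro vector_measure_sums[OF m])
          (auto intro: disjoint_family_subset[OF A(2)])
      moreover have "(\<Union>i. B \<inter> A i) = B"
        using B by auto
      ultimately have "(\<lambda>n. ennreal (\<Sum>i<n. m (B \<inter> A i))) \<longlonglongrightarrow> ennreal (m B)"
        unfolding sums_def by (auto intro: tendsto_ennrealI)
      moreover have "ennreal (\<Sum>i<n. m (B \<inter> A i)) \<le> (\<Sum>i. p (A i))" for n
      proof -
        \<comment> \<open>Replacing negative terms by \<open>0\<close> only enlarges the sum, and on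
          nonnegative terms \<open>ennreal\<close> is additive.\<close>
        have "ennreal (\<Sum>i<n. m (B \<inter> A i)) \<le> ennreal (\<Sum>i<n. max 0 (m (B \<inter> A i)))"
          by (intro ennreal_leI sum_mono) auto
        also have "\<dots> = (\<Sum>i<n. ennreal (m (B \<inter> A i)))"
          by (subst sum_ennreal[symmetric]) (auto simp: ennreal_max_0)
        also have "\<dots> \<le> (\<Sum>i<n. p (A i))"
          using A B by (intro sum_mono upper) auto
        also have "\<dots> \<le> (\<Sum>i. p (A i))"
          by (rule sum_le_suminf) auto
        finally show ?thesis .
      qed
      ultimately show "ennreal (m B) \<le> (\<Sum>i. p (A i))"
        by (intro LIMSEQ_le_const2) auto
    qed
    ultimately show "(\<Sum>i. p (A i)) = p (\<Union>i. A i)"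
      by (rule antisym)
  qed
  moreover have "positive (sets borel) p"
  proof -
    have "{B \<in> sets borel. B \<subseteq> ({}::'a set)} = {{}}"
      by auto
    then show ?thesis
      unfolding positive_def p_def by (simp add: vector_measure_empty[OF m])
  qed
  ultimately have "emeasure (measure_of UNIV (sets borel) p) A = p A"
    using A sets.sigma_sets_eq[of "borel :: 'a measure"]
    by (intro emeasure_measure_of[OF refl]) auto
  then show ?thesis
    by (simp add: positive_part_def p_def[abs_def])
qed

lemma emeasure_positive_part_le:
  assumes "vector_measure m" "A \<in> sets borel"
    and "\<And>B. B \<in> sets borel \<Longrightarrow> B \<subseteq> A \<Longrightarrow> m B \<le> c"
  shows "emeasure (positive_part m) A \<le> ennreal c"
  using assms by (auto simp: emeasure_positive_part intro!: SUP_least ennreal_leI)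

lemma finite_measure_positive_part:
  assumes "vector_measure m" "\<And>B. B \<in> sets borel \<Longrightarrow> m B \<le> c"
  shows "finite_measure (positive_part m)"
proof
  have "emeasure (positive_part m) UNIV \<le> ennreal c"
    using assms by (intro emeasure_positive_part_le) auto
  then show "emeasure (positive_part m) (space (positive_part m)) \<noteq> \<infinity>"
    by (auto simp: top_unique)
qed

lemma le_measure_positive_part:
  assumes "vector_measure m" "finite_measure (positive_part m)"
    and "A \<in> sets borel" "B \<in> sets borel" "B \<subseteq> A"
  shows "m B \<le> measure (positive_part m) A"
proof -
  interpret finite_measure "positive_part m" by fact
  have "ennreal (m B) \<le> emeasure (positive_part m) A"
    using assms by (auto simp: emeasure_positive_part intro!: SUP_upper)
  then show ?thesis
    by (simp add: emeasure_eq_measure)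
qed

text \<open>For \<open>B \<subseteq> A\<close>, the identity \<open>m B = m A - m (A - B)\<close>
  bounds \<open>m B\<close> by \<open>m A\<close> plus the negative part of \<open>A\<close>. The
  supremum over \<open>B\<close> gives one inequality, and the same argument for \<open>- m\<close>
  gives the other.\<close>

lemma Jordan_decomposition:
  assumes m: "vector_measure m" and A: "A \<in> sets borel"
    and fin: "finite_measure (positive_part m)" "finite_measure (positive_part (\<lambda>A. - m A))"
  shows "measure (positive_part m) A - measure (positive_part (\<lambda>A. - m A)) A = m A"
proof -
  define p where "p = measure (positive_part m) A"
  define n where "n = measure (positive_part (\<lambda>A. - m A)) A"
  note m' = vector_measure_uminus[OF m]
  interpret P: finite_measure "positive_part m" by fact
  interpret N: finite_measure "positive_part (\<lambda>A. - m A)" by fact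
  have up: "m B \<le> p" "- m B \<le> n" if "B \<in> sets borel" "B \<subseteq> A" for B
    using le_measure_positive_part[OF m fin(1) A that] le_measure_positive_part[OF m' fin(2) A that]
    by (auto simp: p_def n_def)
  have diff: "m (A - B) = m A - m B" if "B \<in> sets borel" "B \<subseteq> A" for B
    using vector_measure_Diff[OF m A that] .
  have "emeasure (positive_part m) A \<le> ennreal (n + m A)"
  proof (rule emeasure_positive_part_le[OF m A])
    fix B assume B: "B \<in> sets borel" "B \<subseteq> A"
    then have "- m (A - B) \<le> n"
      using A by (intro up) auto
    then show "m B \<le> n + m A"
      using diff[OF B] by simp
  qed
  \<comment> \<open>Without this sign the \<open>ennreal\<close> inequality could not be read back
    in the reals, since \<open>ennreal\<close> sends negative numbers to \<open>0\<close>.\<close>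
  moreover have "0 \<le> n + m A"
    using up[of A] A by auto
  ultimately have "p \<le> n + m A"
    unfolding P.emeasure_eq_measure p_def by simp
  have "emeasure (positive_part (\<lambda>A. - m A)) A \<le> ennreal (p - m A)"
  proof (rule emeasure_positive_part_le[OF m' A])
    fix B assume B: "B \<in> sets borel" "B \<subseteq> A"
    then have "m (A - B) \<le> p"
      using A by (intro up) auto
    then show "- m B \<le> p - m A"
      using diff[OF B] by simp
  qed
  moreover have "0 \<le> p - m A"
    using up[of A] A by auto
  ultimately have "n \<le> p - m A"
    unfolding N.emeasure_eq_measure n_def by simp
  with \<open>p \<le> n + m A\<close> show ?thesis
    by (simp add: p_def n_def)
qed

section \<open>Integrals of bounded functions against the components of a vector measure\<close>

lemma finite_measure_positive_part_component:
  assumes "vector_measure \<mu>" "total_variation \<mu> UNIV < \<infinity>"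
  shows "finite_measure (positive_part (\<lambda>A. \<mu> A \<bullet> b))"
    and "finite_measure (positive_part (\<lambda>A. - (\<mu> A \<bullet> b)))"
proof -
  define V where "V = enn2real (total_variation \<mu> UNIV)"
  have "norm (\<mu> B) \<le> V" if "B \<in> sets borel" for B
    using enn2real_mono[OF norm_le_total_variation[OF assms(1) that]] assms(2)
    by (simp add: V_def)
  then have *: "norm (\<mu> B) * norm b \<le> V * norm b" if "B \<in> sets borel" for B
    using that by (simp add: mult_right_mono)
  have "\<mu> B \<bullet> b \<le> V * norm b" if "B \<in> sets borel" for B
    using Cauchy_Schwarz_ineq2[of "\<mu> B" b] *[OF that] by linarith
  then show "finite_measure (positive_part (\<lambda>A. \<mu> A \<bullet> b))"
    by (rule finite_measure_positive_part[OF vector_measure_inner[OF assms(1)]])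
  have "- (\<mu> B \<bullet> b) \<le> V * norm b" if "B \<in> sets borel" for B
    using Cauchy_Schwarz_ineq2[of "\<mu> B" b] *[OF that] by linarith
  then show "finite_measure (positive_part (\<lambda>A. - (\<mu> A \<bullet> b)))"
    by (rule finite_measure_positive_part[OF
        vector_measure_uminus[OF vector_measure_inner[OF assms(1)]]])
qed

lemma signed_integral_step:
  assumes m: "vector_measure m"
    and fin: "finite_measure (positive_part m)" "finite_measure (positive_part (\<lambda>A. - m A))"
    and A: "\<And>i. i \<in> I \<Longrightarrow> A i \<in> sets borel"
  shows "signed_integral m (\<lambda>x. \<Sum>i\<in>I. c i * indicator (A i) x) = (\<Sum>i\<in>I. c i * m (A i))"
proof -
  have *: "(\<integral>x. (\<Sum>i\<in>I. c i * indicator (A i) x) \<partial>M) = (\<Sum>i\<in>I. c i * measure M (A i))"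
    if "finite_measure M" "sets M = sets borel" for M
  proof -
    interpret finite_measure M by fact
    have "integrable M (indicator (A i) :: 'a \<Rightarrow> real)" if "i \<in> I" for i
      using A[OF that] \<open>sets M = sets borel\<close>
      by (intro integrable_real_indicator) (simp_all add: less_top[symmetric])
    then have "(\<integral>x. (\<Sum>i\<in>I. c i * indicator (A i) x) \<partial>M)
        = (\<Sum>i\<in>I. \<integral>x. c i * indicator (A i) x \<partial>M)"
      by (intro Bochner_Integration.integral_sum integrable_mult_right) simp
    also have "\<dots> = (\<Sum>i\<in>I. c i * measure M (A i))"
      using sets_eq_imp_space_eq[OF \<open>sets M = sets borel\<close>] by simp
    finally show ?thesis .
  qed
  have "signed_integral m (\<lambda>x. \<Sum>i\<in>I. c i * indicator (A i) x) =
      (\<Sum>i\<in>I. c i * (measure (positive_part m) (A i) - measure (positive_part (\<lambda>A. - m A)) (A i)))"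
    by (simp add: signed_integral_def *[OF fin(1)] *[OF fin(2)] sum_subtractf right_diff_distrib)
  then show ?thesis
    using A by (simp add: Jordan_decomposition[OF m _ fin])
qed

text \<open>Estimating each coordinate separately would cost a dimensional constant. For a step
  function the coordinates recombine into \<open>h \<bullet> \<mu> (A i)\<close> before any absolute
  value is taken; Cauchy-Schwarz and the partition form of the total variation then give the sharp
  bound. Dominated convergence extends it to \<open>g\<close>.\<close>

lemma signed_integral_bound:
  fixes \<mu> :: "'a::euclidean_space set \<Rightarrow> 'a" and g :: "'a \<Rightarrow> real"
  assumes \<mu>: "vector_measure \<mu>" "total_variation \<mu> UNIV < \<infinity>"
    and [measurable]: "g \<in> borel_measurable borel"
    and g: "\<And>x. \<bar>g x\<bar> \<le> 1"
  shows "\<bar>\<Sum>b\<in>Basis. (h \<bullet> b) * signed_integral (\<lambda>A. \<mu> A \<bullet> b) g\<bar>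
    \<le> norm h * enn2real (total_variation \<mu> UNIV)"
proof -
  define V where "V = enn2real (total_variation \<mu> UNIV)"
  note fin = finite_measure_positive_part_component[OF \<mu>]
  \<comment> \<open>Rounding down to multiples of \<open>1 / real (Suc n)\<close> approximates
    \<open>g\<close> uniformly, with finitely many values because \<open>g\<close> is bounded by
    \<open>1\<close>.\<close>
  define g' where "g' n x = of_int \<lfloor>real (Suc n) * g x\<rfloor> / real (Suc n)" for n x
  have g'_close: "\<bar>g' n x - g x\<bar> \<le> 1 / real (Suc n)" for n x
  proof -
    have "\<bar>of_int \<lfloor>real (Suc n) * g x\<rfloor> - real (Suc n) * g x\<bar> \<le> 1"
      by linarith
    moreover have "g' n x - g x = (of_int \<lfloor>real (Suc n) * g x\<rfloor> - real (Suc n) * g x) / real (Suc n)"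
      by (simp add: g'_def field_simps)
    ultimately show ?thesis
      by (simp add: divide_right_mono del: of_nat_Suc)
  qed
  have conv: "(\<lambda>n. g' n x) \<longlonglongrightarrow> g x" for x
  proof -
    have "(\<lambda>n. g' n x - g x) \<longlonglongrightarrow> 0"
      by (rule Lim_null_comparison[OF _ lim_1_over_n[THEN LIMSEQ_Suc]])
        (use g'_close in \<open>auto simp del: of_nat_Suc\<close>)
    then show ?thesis
      by (simp add: LIM_zero_iff)
  qed
  have bdd: "\<bar>g' n x\<bar> \<le> 2" for n x
  proof -
    have "1 / real (Suc n) \<le> 1" by simp
    then show ?thesis
      using g'_close[of n x] g[of x] by linarith
  qed
  have [measurable]: "g' n \<in> borel_measurable borel" for n
    unfolding g'_def by measurable
  have int_conv: "(\<lambda>n. \<integral>x. g' n x \<partial>M) \<longlonglongrightarrow> (\<integral>x. g x \<partial>M)"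
    if "finite_measure M" and [measurable_cong, simp]: "sets M = sets borel" for M
  proof -
    interpret finite_measure M by fact
    show ?thesis
      by (rule integral_dominated_convergence[where w = "\<lambda>_. 2"]) (auto simp: conv bdd)
  qed
  have "(\<lambda>n. \<bar>\<Sum>b\<in>Basis. (h \<bullet> b) * signed_integral (\<lambda>A. \<mu> A \<bullet> b) (g' n)\<bar>)
      \<longlonglongrightarrow> \<bar>\<Sum>b\<in>Basis. (h \<bullet> b) * signed_integral (\<lambda>A. \<mu> A \<bullet> b) g\<bar>"
    unfolding signed_integral_def by (intro tendsto_intros int_conv fin) auto
  moreover have "\<bar>\<Sum>b\<in>Basis. (h \<bullet> b) * signed_integral (\<lambda>A. \<mu> A \<bullet> b) (g' n)\<bar> \<le> norm h * V" for n
  proof -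
    \<comment> \<open>The floor ranges from \<open>- int (Suc n)\<close> to
      \<open>int (Suc n)\<close>. Shifting it by \<open>Suc n\<close> gives indices from
      \<open>0\<close> to \<open>2 * Suc n\<close>, hence the additional \<open>Suc\<close> in
      \<open>N\<close>.\<close>
    define A where "A i = {x. \<lfloor>real (Suc n) * g x\<rfloor> = int i - int (Suc n)}" for i
    define c where "c i = (real i - real (Suc n)) / real (Suc n)" for i
    define N where "N = Suc (2 * Suc n)"
    have [measurable]: "A i \<in> sets borel" for i
      unfolding A_def by measurable
    have disj: "disjoint_family_on A {..<N}"
      by (auto simp: A_def disjoint_family_on_def)
    have g'_eq: "g' n = (\<lambda>x. \<Sum>i<N. c i * indicator (A i) x)"
    proof
      fix x
      define k where "k = nat (\<lfloor>real (Suc n) * g x\<rfloor> + int (Suc n))"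
      have "\<bar>real (Suc n) * g x\<bar> \<le> real (Suc n)"
        using mult_left_mono[OF g[of x], of "real (Suc n)"] by (simp add: abs_mult)
      then have "- int (Suc n) \<le> \<lfloor>real (Suc n) * g x\<rfloor>" "\<lfloor>real (Suc n) * g x\<rfloor> \<le> int (Suc n)"
        by linarith+
      then have k: "k < N" "int k - int (Suc n) = \<lfloor>real (Suc n) * g x\<rfloor>"
        by (auto simp: k_def N_def)
      then have "(\<Sum>i<N. c i * indicator (A i) x) = (\<Sum>i<N. if i = k then c i else 0)"
        by (intro sum.cong) (auto simp: A_def indicator_def)
      also have "\<dots> = c k"
        using k by simp
      also have "c k = g' n x"
        unfolding c_def g'_def k(2)[symmetric] by simp
      finally show "g' n x = (\<Sum>i<N. c i * indicator (A i) x)" ..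
    qed
    have "(\<Sum>b\<in>Basis. (h \<bullet> b) * signed_integral (\<lambda>A. \<mu> A \<bullet> b) (g' n))
        = (\<Sum>b\<in>Basis. (h \<bullet> b) * (\<Sum>i<N. c i * (\<mu> (A i) \<bullet> b)))"
      unfolding g'_eq by (subst signed_integral_step[OF vector_measure_inner[OF \<mu>(1)] fin]) auto
    also have "\<dots> = (\<Sum>i<N. c i * (\<Sum>b\<in>Basis. (h \<bullet> b) * (\<mu> (A i) \<bullet> b)))"
      unfolding sum_distrib_left by (subst sum.swap) (simp add: mult_ac)
    also have "\<dots> = (\<Sum>i<N. c i * (h \<bullet> \<mu> (A i)))"
      by (simp add: euclidean_inner[symmetric])
    also have "\<bar>\<dots>\<bar> \<le> (\<Sum>i<N. norm h * norm (\<mu> (A i)))"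
    proof (rule order_trans[OF sum_abs], rule sum_mono)
      fix i assume "i \<in> {..<N}"
      then have "\<bar>c i\<bar> \<le> 1"
        by (auto simp: c_def N_def)
      then have "\<bar>c i\<bar> * \<bar>h \<bullet> \<mu> (A i)\<bar> \<le> 1 * (norm h * norm (\<mu> (A i)))"
        by (intro mult_mono Cauchy_Schwarz_ineq2) auto
      then show "\<bar>c i * (h \<bullet> \<mu> (A i))\<bar> \<le> norm h * norm (\<mu> (A i))"
        by (simp add: abs_mult)
    qed
    also have "\<dots> = norm h * (\<Sum>i<N. norm (\<mu> (A i)))"
      by (simp add: sum_distrib_left)
    also have "\<dots> \<le> norm h * V"
    proof (intro mult_left_mono)
      have "ennreal (\<Sum>i<N. norm (\<mu> (A i))) \<le> total_variation \<mu> UNIV"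
        by (intro sum_norm_le_total_variation \<mu> disj) auto
      then show "(\<Sum>i<N. norm (\<mu> (A i))) \<le> V"
        using \<mu>(2) enn2real_mono by (fastforce simp: V_def sum_nonneg)
    qed auto
    finally show ?thesis .
  qed
  ultimately show ?thesis
    unfolding V_def[symmetric] by (intro LIMSEQ_le_const2) auto
qed

section \<open>Smooth functions and segment averages\<close>

text \<open>\<open>flat_exp 0\<close> is the classical smooth function that is flat at the origin.
  The exponent \<open>n\<close> records the negative powers of \<open>t\<close> that differentiation
  produces, so that derivatives are linear combinations of members of the family.\<close>

definition flat_exp :: "nat \<Rightarrow> real \<Rightarrow> real" where
  "flat_exp n t = (if t \<le> 0 then 0 else exp (- 1 / t) / t ^ n)"

text \<open>Substituting \<open>s = 1 / t\<close> turns the limit from the right into that of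
  \<open>s ^ n / exp s\<close> at infinity.\<close>

lemma flat_exp_tendsto_0: "(flat_exp n \<longlongrightarrow> 0) (at 0)"
proof -
  have "((\<lambda>t. inverse t ^ n / exp (inverse t)) \<longlongrightarrow> (0::real)) (at_right 0)"
    using filterlim_compose[OF tendsto_power_div_exp_0 filterlim_inverse_at_top_right] .
  moreover have "\<forall>\<^sub>F t in at_right 0. inverse t ^ n / exp (inverse t) = flat_exp n t"
    by (intro eventually_at_rightI[of 0 1])
      (auto simp: flat_exp_def exp_minus field_simps)
  ultimately have "(flat_exp n \<longlongrightarrow> 0) (at_right 0)"
    using filterlim_cong by force
  moreover have "(flat_exp n \<longlongrightarrow> 0) (at_left 0)"
    by (rule tendsto_eventually, rule eventually_at_leftI[of "-1"]) (auto simp: flat_exp_def)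
  ultimately show ?thesis
    by (simp add: filterlim_split_at)
qed

lemma flat_exp_DERIV:
  "(flat_exp n has_real_derivative flat_exp (n + 2) t - real n * flat_exp (Suc n) t) (at t)"
proof (cases t "0 :: real" rule: linorder_cases)
  case less
  have "((\<lambda>_. 0) has_real_derivative 0) (at t)"
    by simp
  then have "(flat_exp n has_real_derivative 0) (at t)"
    by (rule has_field_derivative_transform_within_open[of _ _ _ "{..<0}"])
      (use less in \<open>auto simp: flat_exp_def\<close>)
  then show ?thesis
    using less by (simp add: flat_exp_def)
next
  case equal
  \<comment> \<open>The difference quotient at \<open>0\<close> is \<open>flat_exp (Suc n) h\<close>
    for every nonzero \<open>h\<close>, and the claimed derivative is \<open>0\<close>
    there.\<close>
  have "((\<lambda>h. flat_exp n h / h) \<longlongrightarrow> 0) (at 0)"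
  proof (rule Lim_transform_eventually[OF flat_exp_tendsto_0[of "Suc n"]])
    show "\<forall>\<^sub>F h in at 0. flat_exp (Suc n) h = flat_exp n h / h"
      by (auto simp: flat_exp_def eventually_at_filter field_simps)
  qed
  then show ?thesis
    using equal by (simp add: DERIV_def flat_exp_def)
next
  case greater
  have "((\<lambda>t. exp (- 1 / t) / t ^ n) has_real_derivative
      (exp (- 1 / t) / (t * t) * t ^ n - exp (- 1 / t) * (real n * t ^ (n - 1))) / (t ^ n * t ^ n)) (at t)"
    using greater by (auto intro!: derivative_eq_intros)
  also have "(exp (- 1 / t) / (t * t) * t ^ n - exp (- 1 / t) * (real n * t ^ (n - 1))) / (t ^ n * t ^ n)
      = flat_exp (n + 2) t - real n * flat_exp (Suc n) t"
    using greater by (cases n) (auto simp: flat_exp_def field_simps)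
  finally have "((\<lambda>t. exp (- 1 / t) / t ^ n) has_real_derivative
      flat_exp (n + 2) t - real n * flat_exp (Suc n) t) (at t)" .
  then show ?thesis
    by (rule has_field_derivative_transform_within_open[of _ _ _ "{0<..}"])
      (use greater in \<open>auto simp: flat_exp_def\<close>)
qed

text \<open>A class of functions closed under partial derivatives, so that all of its members are smooth.\<close>

inductive smooth_elementary :: "('a::euclidean_space \<Rightarrow> real) \<Rightarrow> bool" where
  const: "smooth_elementary (\<lambda>x. c)"
| linear: "bounded_linear f \<Longrightarrow> smooth_elementary f"
| add: "smooth_elementary f \<Longrightarrow> smooth_elementary g \<Longrightarrow> smooth_elementary (\<lambda>x. f x + g x)"
| mult: "smooth_elementary f \<Longrightarrow> smooth_elementary g \<Longrightarrow> smooth_elementary (\<lambda>x. f x * g x)"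
| flat_exp: "smooth_elementary f \<Longrightarrow> smooth_elementary (\<lambda>x. flat_exp n (f x))"

lemma smooth_elementary_derivative:
  assumes "smooth_elementary f"
  shows "\<exists>f'. (\<forall>x. (f has_derivative f' x) (at x)) \<and> (\<forall>b. smooth_elementary (\<lambda>x. f' x b))"
  using assms
proof induction
  case (const c)
  show ?case
    by (intro exI[of _ "\<lambda>x b. 0"]) (auto intro: smooth_elementary.const)
next
  case (linear f)
  then show ?case
    by (intro exI[of _ "\<lambda>x. f"]) (auto intro: smooth_elementary.const bounded_linear_imp_has_derivative)
next
  case (add f g)
  then obtain f' g' where "\<forall>x. (f has_derivative f' x) (at x)" "\<forall>b. smooth_elementary (\<lambda>x. f' x b)"
    "\<forall>x. (g has_derivative g' x) (at x)" "\<forall>b. smooth_elementary (\<lambda>x. g' x b)"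
    by blast
  then show ?case
    by (intro exI[of _ "\<lambda>x b. f' x b + g' x b"])
      (auto intro: smooth_elementary.add has_derivative_add)
next
  case (mult f g)
  then obtain f' g' where "\<forall>x. (f has_derivative f' x) (at x)" "\<forall>b. smooth_elementary (\<lambda>x. f' x b)"
    "\<forall>x. (g has_derivative g' x) (at x)" "\<forall>b. smooth_elementary (\<lambda>x. g' x b)"
    by blast
  then show ?case
    using mult.hyps by (intro exI[of _ "\<lambda>x b. f x * g' x b + f' x b * g x"])
      (auto intro!: smooth_elementary.add smooth_elementary.mult has_derivative_mult)
next
  case (flat_exp f n)
  then obtain f' where f': "\<forall>x. (f has_derivative f' x) (at x)" "\<forall>b. smooth_elementary (\<lambda>x. f' x b)"
    by blast
  \<comment> \<open>The chain rule, with the subtraction from \<open>flat_exp_DERIV\<close> written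
    as adding a constant multiple, so that the introduction rules of the class apply.\<close>
  have "((\<lambda>x. flat_exp n (f x)) has_derivative
      (\<lambda>b. (flat_exp (n + 2) (f x) + (- real n) * flat_exp (Suc n) (f x)) * f' x b)) (at x)" for x
    using has_derivative_compose[OF f'(1)[rule_format, of x]
        flat_exp_DERIV[of n "f x", unfolded has_field_derivative_def]]
    by simp
  then show ?case
    using flat_exp.hyps f'(2)
    by (intro exI[of _ "\<lambda>x b. (flat_exp (n + 2) (f x) + (- real n) * flat_exp (Suc n) (f x)) * f' x b"])
      (intro conjI allI smooth_elementary.mult smooth_elementary.add smooth_elementary.flat_exp
        smooth_elementary.const; simp)
qed

lemma smooth_elementary_C_k:
  assumes "smooth_elementary f"
  shows "C_k k f"
  using assms
proof (induction k arbitrary: f)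
  case 0
  then show ?case
    using smooth_elementary_derivative[OF 0]
    by (auto intro!: continuous_at_imp_continuous_on intro: has_derivative_continuous)
next
  case (Suc k)
  then obtain f' where f': "\<And>x. (f has_derivative f' x) (at x)" "\<And>b. smooth_elementary (\<lambda>x. f' x b)"
    using smooth_elementary_derivative by blast
  then have "frechet_derivative f (at x) = f' x" for x
    by (metis frechet_derivative_at)
  then show ?case
    using f' Suc.IH by (auto simp: differentiable_def)
qed

lemma smooth_elementary_polynomial:
  assumes "real_polynomial_function p"
  shows "smooth_elementary p"
  using assms by induction (auto intro: smooth_elementary.intros)

section \<open>Averages of differentiable functions along a segment\<close>

lemma C_k_imp_continuous_on:
  assumes "C_k k f"
  shows "continuous_on UNIV f"
  using assms
  by (cases k) (auto intro!: continuous_at_imp_continuous_on differentiable_imp_continuous_within)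

text \<open>Both \<open>C_k\<close> and \<open>is_gradient_measure\<close> speak of basis directions
  only; this expansion carries their content to an arbitrary direction.\<close>

lemma linear_real_eq_sum_Basis:
  fixes f :: "'a::euclidean_space \<Rightarrow> real"
  assumes "linear f"
  shows "f v = (\<Sum>b\<in>Basis. (v \<bullet> b) * f b)"
  using assms by (subst euclidean_representation[of v, symmetric])
    (simp add: linear_sum linear_scale del: euclidean_representation)

lemma C_k_Suc_D:
  assumes "C_k (Suc k) f"
  shows "(f has_derivative frechet_derivative f (at x)) (at x)"
    and "continuous_on UNIV (\<lambda>x. frechet_derivative f (at x) v)"
proof -
  show *: "(f has_derivative frechet_derivative f (at x)) (at x)" for x
    using assms frechet_derivative_works by auto
  have "frechet_derivative f (at x) v = (\<Sum>b\<in>Basis. (v \<bullet> b) * frechet_derivative f (at x) b)" for x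
    using linear_real_eq_sum_Basis[OF has_derivative_linear[OF *]] .
  moreover have "continuous_on UNIV (\<lambda>x. frechet_derivative f (at x) b)" if "b \<in> Basis" for b
    using assms that by (auto intro: C_k_imp_continuous_on)
  ultimately show "continuous_on UNIV (\<lambda>x. frechet_derivative f (at x) v)"
    by (auto intro!: continuous_intros)
qed

text \<open>Differentiation under the integral sign, allowed because the derivative is continuous
  and the segment is compact.\<close>

lemma segment_average_has_derivative:
  fixes f :: "'a::euclidean_space \<Rightarrow> real"
  assumes f: "C_k (Suc k) f"
  shows "((\<lambda>x. integral {0..1} (\<lambda>t. f (x - t *\<^sub>R h))) has_derivative
    (\<lambda>v. integral {0..1} (\<lambda>t. frechet_derivative f (at (x - t *\<^sub>R h)) v))) (at x)"
proof -
  \<comment> \<open>The Leibniz rule asks for a derivative that is continuous as a map into the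
    bounded linear functions; in finite dimension it is enough to check this at each fixed
    vector.\<close>
  define f' where "f' x = Blinfun (frechet_derivative f (at x))" for x
  have f': "blinfun_apply (f' x) = frechet_derivative f (at x)" for x
    unfolding f'_def
    by (intro bounded_linear_Blinfun_apply has_derivative_bounded_linear[OF C_k_Suc_D(1)[OF f]])
  have cont: "continuous_on UNIV f'"
    by (intro continuous_at_imp_continuous_on ballI continuous_blinfun_componentwiseI1)
      (use C_k_Suc_D(2)[OF f] in \<open>auto simp: f' continuous_on_eq_continuous_at\<close>)
  have fcont: "continuous_on UNIV f"
    using f by (rule C_k_imp_continuous_on)
  have "((\<lambda>x. integral (cbox 0 (1::real)) (\<lambda>t. f (x - t *\<^sub>R h))) has_derivative
      integral (cbox 0 1) (\<lambda>t. f' (x - t *\<^sub>R h))) (at x within UNIV)"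
  proof (rule leibniz_rule)
    fix y t
    have "((\<lambda>x. x - t *\<^sub>R h) has_derivative (\<lambda>v. v)) (at y)"
      by (auto intro!: derivative_eq_intros)
    from has_derivative_compose[OF this C_k_Suc_D(1)[OF f]]
    show "((\<lambda>x. f (x - t *\<^sub>R h)) has_derivative f' (y - t *\<^sub>R h)) (at y)"
      by (simp add: f')
  next
    show "(\<lambda>t. f (y - t *\<^sub>R h)) integrable_on cbox 0 1" for y
      by (intro integrable_continuous continuous_on_compose2[OF fcont] continuous_intros) auto
    show "continuous_on (UNIV \<times> cbox 0 1) (\<lambda>(x, t). f' (x - t *\<^sub>R h))"
      unfolding case_prod_beta
      by (intro continuous_on_compose2[OF cont] continuous_intros) auto
  qed auto
  moreover have "blinfun_apply (integral (cbox 0 1) (\<lambda>t. f' (x - t *\<^sub>R h))) =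
      (\<lambda>v. integral (cbox 0 1) (\<lambda>t. frechet_derivative f (at (x - t *\<^sub>R h)) v))"
    by (rule ext, subst blinfun_apply_integral)
      (auto simp: f' intro!: integrable_continuous_interval continuous_on_compose2[OF cont] continuous_intros)
  ultimately show ?thesis
    by (simp add: cbox_interval)
qed

text \<open>A partial derivative of the average is the average of the partial derivative, so
  induction on the order works once \<open>f\<close> is generalized.\<close>

lemma C_k_segment_average:
  assumes "C_k k f"
  shows "C_k k (\<lambda>x. integral {0..1} (\<lambda>t. f (x - t *\<^sub>R h)))"
  using assms
proof (induction k arbitrary: f)
  case 0
  then have "continuous_on UNIV f"
    by simp
  then have "continuous_on (UNIV \<times> cbox 0 1) (\<lambda>(x, t). f (x - t *\<^sub>R h))"
    unfolding case_prod_beta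
    by (rule continuous_on_compose2) (auto intro!: continuous_intros)
  from integral_continuous_on_param[OF this] show ?case
    by (simp add: cbox_interval)
next
  case (Suc k)
  note deriv = segment_average_has_derivative[OF Suc.prems]
  have eq: "frechet_derivative (\<lambda>x. integral {0..1} (\<lambda>t. f (x - t *\<^sub>R h))) (at x) =
      (\<lambda>v. integral {0..1} (\<lambda>t. frechet_derivative f (at (x - t *\<^sub>R h)) v))" for x
    using frechet_derivative_at[OF deriv] by simp
  show ?case
    unfolding C_k.simps eq
  proof (intro conjI allI ballI)
    show "(\<lambda>x. integral {0..1} (\<lambda>t. f (x - t *\<^sub>R h))) differentiable (at x)" for x
      using deriv by (rule differentiableI)
    show "C_k k (\<lambda>x. integral {0..1} (\<lambda>t. frechet_derivative f (at (x - t *\<^sub>R h)) b))"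
      if "b \<in> Basis" for b
      using Suc.prems that by (intro Suc.IH[of "\<lambda>x. frechet_derivative f (at x) b"]) simp
  qed
qed

text \<open>The averaged derivative along \<open>h\<close> integrates minus the derivative of
  \<open>f (x - t h)\<close> in \<open>t\<close>, so the fundamental theorem of calculus leaves only
  the two endpoints.\<close>

lemma segment_average_derivative_along:
  fixes f :: "'a::euclidean_space \<Rightarrow> real"
  assumes f: "C_k (Suc k) f"
  shows "frechet_derivative (\<lambda>x. integral {0..1} (\<lambda>t. f (x - t *\<^sub>R h))) (at x) h = f x - f (x - h)"
proof -
  have "((\<lambda>t. - frechet_derivative f (at (x - t *\<^sub>R h)) h) has_integral
      f (x - 1 *\<^sub>R h) - f (x - 0 *\<^sub>R h)) {0..1}"
  proof (rule fundamental_theorem_of_calculus)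
    fix t :: real
    have 1: "((\<lambda>t. x - t *\<^sub>R h) has_derivative (\<lambda>s. - (s *\<^sub>R h))) (at t within {0..1})"
      by (auto intro!: derivative_eq_intros)
    have "linear (frechet_derivative f (at (x - t *\<^sub>R h)))"
      by (rule has_derivative_linear[OF C_k_Suc_D(1)[OF f]])
    then show "((\<lambda>t. f (x - t *\<^sub>R h)) has_vector_derivative
        - frechet_derivative f (at (x - t *\<^sub>R h)) h) (at t within {0..1})"
      using has_derivative_compose[OF 1 C_k_Suc_D(1)[OF f]]
      by (simp add: has_vector_derivative_def linear_neg linear_scale)
  qed simp
  from integral_unique[OF has_integral_neg[OF this]]
  have "integral {0..1} (\<lambda>t. frechet_derivative f (at (x - t *\<^sub>R h)) h) = f x - f (x - h)"
    by simp
  then show ?thesis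
    by (simp flip: frechet_derivative_at[OF segment_average_has_derivative[OF f]])
qed

section \<open>Supports and bounds of test functions\<close>

lemma test_functionsI:
  assumes "\<And>k. C_k k f" "\<And>x. R < norm x \<Longrightarrow> f x = 0"
  shows "f \<in> test_functions"
proof -
  have "{x. f x \<noteq> 0} \<subseteq> cball 0 R"
    using assms(2) by force
  then have "compact (closure {x. f x \<noteq> 0})"
    using bounded_cball bounded_subset compact_closure by blast
  with assms(1) show ?thesis
    by (simp add: test_functions_def)
qed

lemma test_functions_support:
  assumes "f \<in> test_functions"
  obtains R where "\<And>x. R < norm x \<Longrightarrow> f x = 0"
proof -
  have "bounded {x. f x \<noteq> 0}"
    using assms by (simp add: test_functions_def)
  then obtain R where "\<And>x. f x \<noteq> 0 \<Longrightarrow> norm x \<le> R"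
    unfolding bounded_iff by blast
  then show ?thesis
    by (intro that[of R]) force
qed

lemma segment_average_test_function:
  fixes f :: "'a::euclidean_space \<Rightarrow> real"
  assumes "f \<in> test_functions"
  shows "(\<lambda>x. integral {0..1} (\<lambda>t. f (x - t *\<^sub>R h))) \<in> test_functions"
proof -
  obtain R where R: "\<And>x. R < norm x \<Longrightarrow> f x = 0"
    using test_functions_support[OF assms] by blast
  show ?thesis
  proof (rule test_functionsI)
    show "C_k k (\<lambda>x. integral {0..1} (\<lambda>t. f (x - t *\<^sub>R h)))" for k
      using assms by (intro C_k_segment_average) (simp add: test_functions_def)
    \<comment> \<open>No point of the segment from \<open>x\<close> to \<open>x - h\<close> is
      farther than \<open>norm h\<close> from \<open>x\<close>, so the whole segment avoids the ball
      of radius \<open>R\<close>.\<close>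
    fix x :: 'a assume x: "R + norm h < norm x"
    have "f (x - t *\<^sub>R h) = 0" if "t \<in> {0..1}" for t
    proof (rule R)
      have "norm (t *\<^sub>R h) \<le> norm h"
        using that by (simp add: mult_left_le_one_le)
      then show "R < norm (x - t *\<^sub>R h)"
        using x norm_triangle_ineq2[of x "t *\<^sub>R h"] by linarith
    qed
    then have "integral {0..1} (\<lambda>t. f (x - t *\<^sub>R h)) = integral {0..1} (\<lambda>t::real. 0)"
      by (intro Henstock_Kurzweil_Integration.integral_cong)
    then show "integral {0..1} (\<lambda>t. f (x - t *\<^sub>R h)) = 0"
      by simp
  qed
qed

lemma bounded_continuous_zero_outside:
  fixes f :: "'a::euclidean_space \<Rightarrow> real"
  assumes "continuous_on UNIV f" "\<And>x. R < norm x \<Longrightarrow> f x = 0"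
  obtains B where "\<And>x. \<bar>f x\<bar> \<le> B"
proof -
  have "compact (f ` cball 0 R)"
    using assms(1) by (intro compact_continuous_image) (auto intro: continuous_on_subset)
  then obtain B where "\<And>x. x \<in> cball 0 R \<Longrightarrow> \<bar>f x\<bar> \<le> B"
    using compact_imp_bounded bounded_iff by (metis image_eqI real_norm_def)
  then have "\<bar>f x\<bar> \<le> max B 0" for x
    using assms(2)[of x] by (cases "R < norm x") (auto simp: le_max_iff_disj)
  then show ?thesis
    using that by blast
qed

text \<open>This makes the product of \<open>u\<close> with a derivative of a test function
  integrable. The derivative is continuous, and it vanishes on the open set
  \<open>R < norm x\<close>, where the function itself is constantly zero.\<close>

lemma test_function_derivative_bounded:
  fixes f :: "'a::euclidean_space \<Rightarrow> real"
  assumes "f \<in> test_functions"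
  obtains B where "\<And>x. \<bar>frechet_derivative f (at x) v\<bar> \<le> B"
proof -
  obtain R where R: "\<And>x. R < norm x \<Longrightarrow> f x = 0"
    using test_functions_support[OF assms] by blast
  have 1: "C_k (Suc 0) f"
    using assms unfolding test_functions_def by blast
  show ?thesis
  proof (rule bounded_continuous_zero_outside[OF C_k_Suc_D(2)[OF 1]])
    fix x :: 'a assume x: "R < norm x"
    have "open {x::'a. R < norm x}"
      by (intro open_Collect_less continuous_intros)
    then have "(f has_derivative (\<lambda>_. 0)) (at x)"
      by (rule has_derivative_transform_within_open[OF has_derivative_const[of 0]]) (use R x in auto)
    from frechet_derivative_at[OF this]
    show "frechet_derivative f (at x) v = 0"
      by metis
  qed (rule that)
qed

section \<open>Approximation of the sign by test functions\<close>

text \<open>The squared norm keeps the function smooth at the origin, and the factor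
  \<open>exp 1\<close> normalizes its maximum, attained there, to \<open>1\<close>.\<close>

definition cutoff :: "real \<Rightarrow> 'a::euclidean_space \<Rightarrow> real" where
  "cutoff R x = exp 1 * flat_exp 0 (1 - (x \<bullet> x) / R\<^sup>2)"

lemma cutoff_nonneg: "0 \<le> cutoff R x"
  by (simp add: cutoff_def flat_exp_def)

lemma cutoff_le_1: "cutoff R x \<le> 1"
proof -
  have "flat_exp 0 t \<le> exp (- 1)" if "t \<le> 1" for t
    using that by (auto simp: flat_exp_def field_simps)
  from this[of "1 - (x \<bullet> x) / R\<^sup>2"] show ?thesis
    by (simp add: cutoff_def exp_minus field_simps)
qed

lemma cutoff_eq_0:
  assumes "0 < R" "R < norm x"
  shows "cutoff R x = 0"
proof -
  have "R\<^sup>2 \<le> x \<bullet> x"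
    unfolding power2_norm_eq_inner[symmetric] using assms by (intro power_mono) auto
  then show ?thesis
    using assms by (simp add: cutoff_def flat_exp_def field_simps)
qed

lemma cutoff_tendsto_1: "(\<lambda>n. cutoff (real (Suc n)) x) \<longlonglongrightarrow> 1"
proof -
  have "isCont (flat_exp 0) 1"
    using flat_exp_DERIV DERIV_isCont by blast
  moreover have "(\<lambda>n. 1 - (x \<bullet> x) * (1 / real (Suc n))\<^sup>2) \<longlonglongrightarrow> 1 - (x \<bullet> x) * 0\<^sup>2"
    by (intro tendsto_intros LIMSEQ_Suc[OF lim_1_over_n])
  then have "(\<lambda>n. 1 - (x \<bullet> x) / (real (Suc n))\<^sup>2) \<longlonglongrightarrow> 1"
    by (simp add: power_divide)
  ultimately have "(\<lambda>n. cutoff (real (Suc n)) x) \<longlonglongrightarrow> exp 1 * flat_exp 0 1"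
    unfolding cutoff_def by (intro tendsto_intros isCont_tendsto_compose[where g = "flat_exp 0"])
  then show ?thesis
    by (simp add: flat_exp_def exp_minus)
qed

lemma smooth_elementary_cutoff: "smooth_elementary (cutoff R)"
proof -
  \<comment> \<open>Induction over sets of vectors; the full basis then yields the squared norm as a
    sum of products of linear maps.\<close>
  have "smooth_elementary (\<lambda>x::'a. \<Sum>b\<in>B. (x \<bullet> b) * (x \<bullet> b))" if "finite B" for B
    using that
  proof induction
    case (insert b B)
    then show ?case
      by (simp add: smooth_elementary.add smooth_elementary.mult
          smooth_elementary.linear[OF bounded_linear_inner_left])
  qed (simp add: smooth_elementary.const)
  from this[OF finite_Basis] have "smooth_elementary (\<lambda>x::'a. x \<bullet> x)"
    by (simp add: euclidean_inner[symmetric])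
  then have "smooth_elementary (\<lambda>x::'a. exp 1 * flat_exp 0 (1 + (- 1 / R\<^sup>2) * (x \<bullet> x)))"
    by (intro smooth_elementary.mult smooth_elementary.flat_exp smooth_elementary.add
        smooth_elementary.const)
  then show ?thesis
    by (simp add: cutoff_def[abs_def])
qed

text \<open>A measurable function is the limit of continuous ones outside a negligible set. Each of
  these is replaced by a polynomial close to it on a ball that grows with \<open>n\<close>; outside
  this ball the polynomial is uncontrolled, but the cutoff vanishes.\<close>

lemma test_functions_approximate_sgn:
  fixes w :: "'a::euclidean_space \<Rightarrow> real"
  assumes [measurable]: "w \<in> borel_measurable borel"
  obtains \<phi> where "\<And>n::nat. \<phi> n \<in> test_functions" "\<And>n x. \<bar>\<phi> n x\<bar> \<le> 1"
    "AE x in lborel. (\<lambda>n. \<phi> n x) \<longlonglongrightarrow> sgn (w x)"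
proof -
  have "(\<lambda>x. sgn (w x)) \<in> borel_measurable lebesgue"
    by (intro measurable_completion) simp
  then have "(\<lambda>x. sgn (w x)) measurable_on UNIV"
    by (simp add: measurable_on_iff_borel_measurable)
  then obtain N g where N: "negligible N" and g: "\<And>n. continuous_on UNIV (g n)"
    and lim: "\<And>x. x \<notin> N \<Longrightarrow> (\<lambda>n. g n x) \<longlonglongrightarrow> sgn (w x)"
    unfolding measurable_on_def by auto
  \<comment> \<open>Clipping supplies the uniform bound and leaves the limit unchanged, since
    \<open>sgn\<close> has values in \<open>[-1, 1]\<close>.\<close>
  define c where "c n x = max (- 1) (min 1 (g n x))" for n x
  have "\<exists>p. real_polynomial_function p \<and> (\<forall>x\<in>cball 0 (real (Suc n)). \<bar>c n x - p x\<bar> < 1 / real (Suc n))" for n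
  proof -
    have "continuous_on (cball 0 (real (Suc n))) (c n)"
      unfolding c_def by (intro continuous_intros continuous_on_subset[OF g]) auto
    then show ?thesis
      using Stone_Weierstrass_real_polynomial_function[OF compact_cball, of 0 "real (Suc n)" "c n" "1 / real (Suc n)"]
      by (metis divide_pos_pos of_nat_0_less_iff zero_less_Suc zero_less_one)
  qed
  then obtain p where p: "\<And>n. real_polynomial_function (p n)"
    and cp: "\<And>n x. norm x \<le> real (Suc n) \<Longrightarrow> \<bar>c n x - p n x\<bar> < 1 / real (Suc n)"
    by (metis mem_cball_0)
  \<comment> \<open>On its ball the polynomial is bounded by \<open>1 + 1 / real (Suc n)\<close>.
    Dividing by this number restores the bound \<open>1\<close>, and the factor tends to
    \<open>1\<close>.\<close>
  define \<phi> where "\<phi> n x = inverse (1 + 1 / real (Suc n)) * (p n x * cutoff (real (Suc n)) x)" for n x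
  have zero: "\<phi> n x = 0" if "real (Suc n) < norm x" for n x
    using cutoff_eq_0[OF _ that] by (simp add: \<phi>_def)
  show thesis
  proof
    show "\<phi> n \<in> test_functions" for n
    proof (rule test_functionsI)
      have "smooth_elementary (\<phi> n)"
        unfolding \<phi>_def by (intro smooth_elementary.mult smooth_elementary.const
            smooth_elementary_polynomial p smooth_elementary_cutoff)
      then show "C_k k (\<phi> n)" for k
        by (rule smooth_elementary_C_k)
    qed (rule zero)
    show "\<bar>\<phi> n x\<bar> \<le> 1" for n x
    proof (cases "norm x \<le> real (Suc n)")
      case True
      define r where "r = 1 / real (Suc n)"
      have r: "0 < r"
        by (simp add: r_def)
      have "\<bar>c n x\<bar> \<le> 1"
        by (auto simp: c_def)
      with cp[OF True] have "\<bar>p n x\<bar> \<le> 1 + r"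
        unfolding r_def[symmetric] by linarith
      then have "\<bar>p n x * cutoff (real (Suc n)) x\<bar> \<le> (1 + r) * 1"
        unfolding abs_mult abs_of_nonneg[OF cutoff_nonneg] using r cutoff_nonneg cutoff_le_1
        by (intro mult_mono) auto
      then show ?thesis
        using r unfolding \<phi>_def r_def[symmetric] by (simp add: abs_mult field_simps)
    next
      case False
      then show ?thesis
        using zero[of n x] by simp
    qed
    have "(\<lambda>n. \<phi> n x) \<longlonglongrightarrow> sgn (w x)" if "x \<notin> N" for x
    proof -
      have "(\<lambda>n. c n x) \<longlonglongrightarrow> max (- 1) (min 1 (sgn (w x)))"
        unfolding c_def by (intro tendsto_intros lim that)
      also have "max (- 1) (min 1 (sgn (w x))) = sgn (w x)"
        by (auto simp: sgn_real_def)
      finally have c_lim: "(\<lambda>n. c n x) \<longlonglongrightarrow> sgn (w x)" .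
      have "(\<lambda>n. p n x - c n x) \<longlonglongrightarrow> 0"
      proof (rule Lim_null_comparison[OF _ LIMSEQ_Suc[OF lim_1_over_n]])
        show "\<forall>\<^sub>F n in sequentially. norm (p n x - c n x) \<le> 1 / real (Suc n)"
          using eventually_ge_at_top[of "nat \<lceil>norm x\<rceil>"]
        proof eventually_elim
          case (elim n)
          then have "norm x \<le> real (Suc n)"
            by linarith
          from cp[OF this] show ?case
            by (simp add: abs_minus_commute)
        qed
      qed
      from tendsto_add[OF this c_lim] have "(\<lambda>n. p n x) \<longlonglongrightarrow> sgn (w x)"
        by simp
      then have "(\<lambda>n. \<phi> n x) \<longlonglongrightarrow> inverse (1 + 0) * (sgn (w x) * 1)"
        unfolding \<phi>_def
        by (intro tendsto_intros cutoff_tendsto_1 LIMSEQ_Suc[OF lim_1_over_n]) auto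
      then show ?thesis
        by simp
    qed
    moreover have "AE x in lborel. x \<notin> N"
      using N by (metis AE_completion_iff AE_not_in negligible_iff_null_sets)
    ultimately show "AE x in lborel. (\<lambda>n. \<phi> n x) \<longlonglongrightarrow> sgn (w x)"
      by auto
  qed
qed

section \<open>The translation estimate\<close>

lemma lborel_integral_translate:
  fixes f :: "'a::euclidean_space \<Rightarrow> real"
  assumes [measurable]: "f \<in> borel_measurable borel"
  shows "(\<integral>x. f (h + x) \<partial>lborel) = (\<integral>x. f x \<partial>lborel)"
  by (subst (2) lborel_distr_plus[of h, symmetric], subst integral_distr) auto

lemma lborel_integrable_translate:
  fixes f :: "'a::euclidean_space \<Rightarrow> real"
  assumes "integrable lborel f"
  shows "integrable lborel (\<lambda>x. f (h + x))"
proof (subst integrable_distr_eq[of "(+) h" lborel borel f, symmetric])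
  show "integrable (distr lborel borel ((+) h)) f"
    using assms by (simp add: lborel_distr_plus)
  show "f \<in> borel_measurable borel"
    using borel_measurable_integrable[OF assms] by simp
qed auto

lemma integrable_mult_bounded:
  fixes f g :: "'a \<Rightarrow> real"
  assumes f: "integrable M f" and [measurable]: "g \<in> borel_measurable M" and "\<And>x. \<bar>g x\<bar> \<le> B"
  shows "integrable M (\<lambda>x. f x * g x)"
proof (rule Bochner_Integration.integrable_bound)
  show "integrable M (\<lambda>x. B * f x)"
    using f by simp
  show "(\<lambda>x. f x * g x) \<in> borel_measurable M"
    using borel_measurable_integrable[OF f] by measurable
  show "AE x in M. norm (f x * g x) \<le> norm (B * f x)"
  proof (rule AE_I2)
    fix x
    have "\<bar>g x\<bar> * \<bar>f x\<bar> \<le> \<bar>B\<bar> * \<bar>f x\<bar>"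
      by (intro mult_right_mono order_trans[OF assms(3) abs_ge_self]) auto
    then show "norm (f x * g x) \<le> norm (B * f x)"
      by (simp add: abs_mult mult.commute)
  qed
qed

lemma difference_pairing_bound:
  fixes u :: "'a::euclidean_space \<Rightarrow> real"
  assumes u: "integrable lborel u" and \<mu>: "is_gradient_measure u \<mu>"
    and \<phi>: "\<phi> \<in> test_functions" "\<And>x. \<bar>\<phi> x\<bar> \<le> 1"
  shows "(\<integral>y. (u (h + y) - u y) * \<phi> y \<partial>lborel) \<le> norm h * enn2real (total_variation \<mu> UNIV)"
proof -
  define \<psi> where "\<psi> x = integral {0..1} (\<lambda>t. \<phi> (x - t *\<^sub>R h))" for x
  have C: "C_k k \<phi>" for k
    using \<phi>(1) by (simp add: test_functions_def)
  have \<psi>: "\<psi> \<in> test_functions"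
    unfolding \<psi>_def by (intro segment_average_test_function \<phi>)
  have C\<psi>: "C_k k \<psi>" for k
    using \<psi> by (simp add: test_functions_def)
  have along: "frechet_derivative \<psi> (at x) h = \<phi> x - \<phi> (x - h)" for x
    unfolding \<psi>_def using C[of "Suc 0"] by (rule segment_average_derivative_along)
  have \<phi>_cont: "continuous_on UNIV \<phi>"
    using C by (rule C_k_imp_continuous_on)
  have [measurable]: "\<phi> \<in> borel_measurable borel"
    using \<phi>_cont by (rule borel_measurable_continuous_onI)
  have [measurable]: "\<psi> \<in> borel_measurable borel"
    using C_k_imp_continuous_on[OF C\<psi>] by (rule borel_measurable_continuous_onI)
  have [measurable]: "u \<in> borel_measurable borel"
    using borel_measurable_integrable[OF u] by simp
  have \<psi>_bound: "\<bar>\<psi> x\<bar> \<le> 1" for x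
  proof -
    have "norm (integral {0..1} (\<lambda>t. \<phi> (x - t *\<^sub>R h))) \<le> 1 * (1 - 0)"
      using \<phi>(2) by (intro integral_bound continuous_on_compose2[OF \<phi>_cont] continuous_intros) auto
    then show ?thesis
      by (simp add: \<psi>_def)
  qed
  have shift: "integrable lborel (\<lambda>y. u y * \<phi> (y - h))" "integrable lborel (\<lambda>y. u y * \<phi> y)"
    "integrable lborel (\<lambda>y. u (h + y) * \<phi> y)"
    using \<phi>(2) by (auto intro!: integrable_mult_bounded[where B = 1] u lborel_integrable_translate)
  have "(\<integral>y. (u (h + y) - u y) * \<phi> y \<partial>lborel) =
      (\<integral>y. u (h + y) * \<phi> y \<partial>lborel) - (\<integral>y. u y * \<phi> y \<partial>lborel)"
    using shift by (simp add: left_diff_distrib)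
  \<comment> \<open>Translation invariance of Lebesgue measure moves the shift from \<open>u\<close>
    to \<open>\<phi>\<close>.\<close>
  also have "(\<integral>y. u (h + y) * \<phi> y \<partial>lborel) = (\<integral>y. u y * \<phi> (y - h) \<partial>lborel)"
    using lborel_integral_translate[of "\<lambda>y. u y * \<phi> (y - h)" h] by simp
  also have "(\<integral>y. u y * \<phi> (y - h) \<partial>lborel) - (\<integral>y. u y * \<phi> y \<partial>lborel) =
      - (\<integral>y. u y * (\<phi> y - \<phi> (y - h)) \<partial>lborel)"
    using shift by (simp add: right_diff_distrib)
  \<comment> \<open>Integration by parts is available along basis vectors only, so the derivative of
    \<open>\<psi>\<close> along \<open>h\<close> is expanded in the basis.\<close>
  also have "(\<integral>y. u y * (\<phi> y - \<phi> (y - h)) \<partial>lborel) =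
      (\<integral>y. (\<Sum>b\<in>Basis. (h \<bullet> b) * (u y * frechet_derivative \<psi> (at y) b)) \<partial>lborel)"
  proof (rule Bochner_Integration.integral_cong[OF refl])
    fix y
    have "frechet_derivative \<psi> (at y) h = (\<Sum>b\<in>Basis. (h \<bullet> b) * frechet_derivative \<psi> (at y) b)"
      by (rule linear_real_eq_sum_Basis[OF has_derivative_linear[OF C_k_Suc_D(1)[OF C\<psi>]]])
    then show "u y * (\<phi> y - \<phi> (y - h)) =
        (\<Sum>b\<in>Basis. (h \<bullet> b) * (u y * frechet_derivative \<psi> (at y) b))"
      by (simp add: along[symmetric] sum_distrib_left mult_ac)
  qed
  also have "\<dots> = (\<Sum>b\<in>Basis. (h \<bullet> b) * (\<integral>y. u y * frechet_derivative \<psi> (at y) b \<partial>lborel))"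
  proof -
    have "integrable lborel (\<lambda>y. u y * frechet_derivative \<psi> (at y) b)" for b
    proof -
      obtain B where "\<And>x. \<bar>frechet_derivative \<psi> (at x) b\<bar> \<le> B"
        using test_function_derivative_bounded[OF \<psi>] by blast
      moreover have "(\<lambda>x. frechet_derivative \<psi> (at x) b) \<in> borel_measurable lborel"
        using borel_measurable_continuous_onI[OF C_k_Suc_D(2)[OF C\<psi>]] by simp
      ultimately show ?thesis
        by (intro integrable_mult_bounded u)
    qed
    then show ?thesis
      by (simp add: Bochner_Integration.integral_sum)
  qed
  also have "\<dots> = - (\<Sum>b\<in>Basis. (h \<bullet> b) * signed_integral (\<lambda>A. \<mu> A \<bullet> b) \<psi>)"
    using \<mu> \<psi> by (simp add: is_gradient_measure_def sum_negf)
  also have "- (- (\<Sum>b\<in>Basis. (h \<bullet> b) * signed_integral (\<lambda>A. \<mu> A \<bullet> b) \<psi>)) \<le>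
      norm h * enn2real (total_variation \<mu> UNIV)"
    using signed_integral_bound[of \<mu> \<psi> h] \<mu> \<psi>_bound
    by (simp add: is_gradient_measure_def abs_le_iff)
  finally show ?thesis .
qed

lemma BV_translation_estimate:
  fixes u :: "'a::euclidean_space \<Rightarrow> real"
  assumes u: "integrable lborel u" and \<mu>: "is_gradient_measure u \<mu>"
  shows "(\<integral>\<^sup>+y. ennreal \<bar>u (h + y) - u y\<bar> \<partial>lborel) \<le> ennreal (norm h) * total_variation \<mu> UNIV"
proof -
  define w where "w y = u (h + y) - u y" for y
  have w: "integrable lborel w"
    unfolding w_def by (intro Bochner_Integration.integrable_diff lborel_integrable_translate u)
  then have [measurable]: "w \<in> borel_measurable borel"
    by (auto dest: borel_measurable_integrable)
  obtain \<phi> where \<phi>: "\<And>n::nat. \<phi> n \<in> test_functions" "\<And>n x. \<bar>\<phi> n x\<bar> \<le> 1"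
    and lim: "AE x in lborel. (\<lambda>n. \<phi> n x) \<longlonglongrightarrow> sgn (w x)"
    using test_functions_approximate_sgn[OF \<open>w \<in> borel_measurable borel\<close>] by blast
  have [measurable]: "\<phi> n \<in> borel_measurable borel" for n
    using \<phi>(1)[of n] by (auto simp: test_functions_def intro!: borel_measurable_continuous_onI
        intro: C_k_imp_continuous_on[of 0])
  \<comment> \<open>The functions \<open>\<phi> n\<close> are bounded by \<open>1\<close>, so
    \<open>\<bar>w\<bar>\<close> dominates, and the limit is the integral of
    \<open>w y * sgn (w y) = \<bar>w y\<bar>\<close>.\<close>
  have "(\<lambda>n. \<integral>y. w y * \<phi> n y \<partial>lborel) \<longlonglongrightarrow> (\<integral>y. w y * sgn (w y) \<partial>lborel)"
  proof (rule integral_dominated_convergence)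
    show "AE x in lborel. (\<lambda>n. w x * \<phi> n x) \<longlonglongrightarrow> w x * sgn (w x)"
      using lim by eventually_elim (intro tendsto_intros)
    show "integrable lborel (\<lambda>y. \<bar>w y\<bar>)"
      using w by simp
    show "AE x in lborel. norm (w x * \<phi> n x) \<le> \<bar>w x\<bar>" for n
      using \<phi>(2) by (auto simp: abs_mult intro!: mult_left_le)
  qed auto
  then have "(\<integral>y. w y * sgn (w y) \<partial>lborel) \<le> norm h * enn2real (total_variation \<mu> UNIV)"
    using difference_pairing_bound[OF u \<mu> \<phi>, of h] by (intro LIMSEQ_le_const2) (auto simp: w_def)
  then have *: "(\<integral>y. \<bar>w y\<bar> \<partial>lborel) \<le> norm h * enn2real (total_variation \<mu> UNIV)"
    by (simp add: abs_sgn[symmetric])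
  have "(\<integral>\<^sup>+y. ennreal \<bar>w y\<bar> \<partial>lborel) = ennreal (\<integral>y. \<bar>w y\<bar> \<partial>lborel)"
    using w by (intro nn_integral_eq_integral) auto
  also have "\<dots> \<le> ennreal (norm h * enn2real (total_variation \<mu> UNIV))"
    using * by (rule ennreal_leI)
  \<comment> \<open>\<open>enn2real\<close> can be undone because a gradient measure has finite
    total variation; infinity would have been sent to \<open>0\<close>.\<close>
  also have "\<dots> = ennreal (norm h) * total_variation \<mu> UNIV"
    using \<mu> by (simp add: ennreal_mult is_gradient_measure_def)
  finally show ?thesis
    by (simp add: w_def)
qed

section \<open>From the translation estimate to the energy bounds\<close>

lemma translation_difference_le:
  fixes u :: "'a::euclidean_space \<Rightarrow> real"
  assumes [measurable]: "u \<in> borel_measurable borel"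
  shows "(\<integral>\<^sup>+y. ennreal \<bar>u (h + y) - u y\<bar> \<partial>lborel) \<le> 2 * (\<integral>\<^sup>+y. ennreal \<bar>u y\<bar> \<partial>lborel)"
proof -
  have "(\<integral>\<^sup>+y. ennreal \<bar>u (h + y) - u y\<bar> \<partial>lborel)
      \<le> (\<integral>\<^sup>+y. ennreal \<bar>u (h + y)\<bar> + ennreal \<bar>u y\<bar> \<partial>lborel)"
    by (intro nn_integral_mono) (simp flip: ennreal_plus add: ennreal_leI)
  also have "\<dots> = (\<integral>\<^sup>+y. ennreal \<bar>u (h + y)\<bar> \<partial>lborel) + (\<integral>\<^sup>+y. ennreal \<bar>u y\<bar> \<partial>lborel)"
    by (rule nn_integral_add) auto
  also have "(\<integral>\<^sup>+y. ennreal \<bar>u (h + y)\<bar> \<partial>lborel) = (\<integral>\<^sup>+y. ennreal \<bar>u y\<bar> \<partial>lborel)"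
    by (subst (2) lborel_distr_plus[of h, symmetric], subst nn_integral_distr) auto
  finally show ?thesis
    by (simp add: mult_2)
qed

text \<open>Tonelli's theorem needs this. By Markov's inequality the sets where
  \<open>min 1 (norm x)\<close> is at least \<open>1 / n\<close> have finite measure; they exhaust
  everything but the origin, which is a null set.\<close>

lemma sigma_finite_truncated_first_moment:
  fixes \<nu> :: "'a::real_normed_vector measure"
  assumes sets[measurable_cong]: "sets \<nu> = sets borel"
    and fin: "(\<integral>\<^sup>+x. ennreal (min 1 (norm x)) \<partial>\<nu>) < \<infinity>"
    and zero: "emeasure \<nu> {0} = 0"
  shows "sigma_finite_measure \<nu>"
proof
  define A :: "nat \<Rightarrow> 'a set" where "A n = {x. 1 \<le> real n * min 1 (norm x)}" for n
  have sp: "space \<nu> = UNIV"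
    using sets_eq_imp_space_eq[OF sets] by simp
  have A_borel: "A n \<in> sets borel" for n
    unfolding A_def by measurable
  have "emeasure \<nu> (A n) \<noteq> \<infinity>" for n
  proof -
    have "emeasure \<nu> {x \<in> UNIV. 1 \<le> of_nat n * ennreal (min 1 (norm x))}
        \<le> of_nat n * (\<integral>\<^sup>+x. ennreal (min 1 (norm x)) * indicator UNIV x \<partial>\<nu>)"
      using sets by (intro nn_integral_Markov_inequality) auto
    also have "\<dots> < \<infinity>"
      using fin by (simp add: ennreal_mult_less_top of_nat_less_top)
    also have "{x \<in> UNIV. 1 \<le> of_nat n * ennreal (min 1 (norm x))} = A n"
    proof -
      have "of_nat n * ennreal (min 1 (norm x)) = ennreal (real n * min 1 (norm x))" for x :: 'a
        by (simp add: ennreal_mult ennreal_of_nat_eq_real_of_nat)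
      then show ?thesis
        by (auto simp: A_def ennreal_1[symmetric] simp del: ennreal_1)
    qed
    finally show ?thesis
      by simp
  qed
  moreover have "(\<Union>n. A n) \<union> {0} = UNIV"
  proof -
    have "\<exists>n. x \<in> A n" if "x \<noteq> 0" for x
    proof -
      obtain n where "1 / min 1 (norm x) \<le> real n"
        using real_arch_simple by blast
      then show ?thesis
        using that unfolding A_def by (intro exI[of _ n]) (simp add: field_simps)
    qed
    then show ?thesis
      by blast
  qed
  ultimately show "\<exists>A. countable A \<and> A \<subseteq> sets \<nu> \<and> \<Union> A = space \<nu> \<and> (\<forall>a\<in>A. emeasure \<nu> a \<noteq> \<infinity>)"
    using zero sets A_borel sp by (intro exI[of _ "insert {0} (range A)"]) auto
qed

theorem proposition2p4:
  fixes \<nu> :: "'a::euclidean_space measure" and u :: "'a \<Rightarrow> real"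
  assumes "sets \<nu> = sets borel"
    and "(\<integral>\<^sup>+x. ennreal (min 1 (norm x)) \<partial>\<nu>) < \<infinity>"
    and "emeasure \<nu> {0} = 0"
    and "u \<in> BV"
  shows "nonlocal_energy \<nu> u \<le> (\<integral>\<^sup>+x. ennreal (min 1 (norm x)) \<partial>\<nu>) * BV_norm u \<and>
         nonlocal_energy \<nu> u \<le> (\<integral>\<^sup>+x. ennreal (norm x) \<partial>\<nu>) * total_variation (Grad u) UNIV"
proof -
  define V where "V = total_variation (Grad u) UNIV"
  define L where "L = (\<integral>\<^sup>+y. ennreal \<bar>u y\<bar> \<partial>lborel)"
  define D where "D x = (\<integral>\<^sup>+y. ennreal \<bar>u (x + y) - u y\<bar> \<partial>lborel)" for x
  note sets [measurable_cong] = assms(1)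
  \<comment> \<open>Membership in \<open>BV\<close> provides some gradient measure, so the choice in
    \<open>Grad\<close> is one as well, and the translation estimate applies to it.\<close>
  have u: "integrable lborel u" and grad: "is_gradient_measure u (Grad u)"
    using assms(4) unfolding BV_def Grad_def by (auto intro: someI[of "is_gradient_measure u"])
  have [measurable]: "u \<in> borel_measurable borel"
    using borel_measurable_integrable[OF u] by simp
  interpret \<nu>: sigma_finite_measure \<nu>
    using assms(1-3) by (rule sigma_finite_truncated_first_moment)
  interpret pair_sigma_finite \<nu> lborel ..
  \<comment> \<open>Joint measurability allows the order of integration to be exchanged, so that for
    each fixed shift \<open>x\<close> the inner integral is \<open>D x\<close>.\<close>
  have "(\<lambda>(x, y). ennreal \<bar>u (x + y) - u y\<bar>) \<in> borel_measurable (\<nu> \<Otimes>\<^sub>M lborel)"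
    by measurable
  then have energy: "nonlocal_energy \<nu> u = ennreal (1/2) * (\<integral>\<^sup>+x. D x \<partial>\<nu>)"
    unfolding nonlocal_energy_def D_def by (subst Fubini') auto
  have "ennreal (1/2) * ennreal 2 = ennreal (1/2 * 2)"
    by (rule ennreal_mult[symmetric]) auto
  then have half: "ennreal (1/2) * (2 * c) = c" for c :: ennreal
    unfolding mult.assoc[symmetric] by (simp only: ennreal_numeral) simp
  have half_le: "ennreal (1/2) * c \<le> c" for c :: ennreal
  proof -
    have "ennreal (1/2) \<le> ennreal 1"
      by (rule ennreal_leI) simp
    from mult_right_mono[OF this, of c] show ?thesis
      by (simp only: ennreal_1 mult_1) simp
  qed
  have D_V: "D x \<le> ennreal (norm x) * V" for x
    unfolding D_def V_def by (rule BV_translation_estimate[OF u grad])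
  have D_L: "D x \<le> 2 * L" for x
    unfolding D_def L_def by (rule translation_difference_le) simp
  \<comment> \<open>For shifts of length at most \<open>1\<close> the factor one half is simply
    dropped; for longer ones it cancels the \<open>2\<close> of the trivial bound, which gives
    exactly the constant in (i).\<close>
  have D_min: "ennreal (1/2) * D x \<le> ennreal (min 1 (norm x)) * (L + V)" for x
  proof (cases "norm x \<le> 1")
    case True
    have "ennreal (1/2) * D x \<le> ennreal (norm x) * V"
      using half_le D_V order_trans by blast
    also have "\<dots> \<le> ennreal (norm x) * (L + V)"
      by (intro mult_left_mono) auto
    finally show ?thesis
      using True by (simp add: min_def)
  next
    case False
    have "ennreal (1/2) * D x \<le> ennreal (1/2) * (2 * L)"
      using D_L by (intro mult_left_mono) auto
    also have "\<dots> \<le> L + V"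
      unfolding half by simp
    finally show ?thesis
      using False by (simp add: min_def)
  qed
  have D_meas [measurable]: "D \<in> borel_measurable \<nu>"
    unfolding D_def by measurable
  have "nonlocal_energy \<nu> u = (\<integral>\<^sup>+x. ennreal (1/2) * D x \<partial>\<nu>)"
    by (simp add: energy nn_integral_cmult)
  also have "\<dots> \<le> (\<integral>\<^sup>+x. ennreal (min 1 (norm x)) * (L + V) \<partial>\<nu>)"
    using D_min by (intro nn_integral_mono)
  also have "\<dots> = (\<integral>\<^sup>+x. ennreal (min 1 (norm x)) \<partial>\<nu>) * BV_norm u"
    by (simp add: nn_integral_multc BV_norm_def L_def V_def)
  finally have 1: "nonlocal_energy \<nu> u \<le> (\<integral>\<^sup>+x. ennreal (min 1 (norm x)) \<partial>\<nu>) * BV_norm u" .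
  have "nonlocal_energy \<nu> u \<le> (\<integral>\<^sup>+x. D x \<partial>\<nu>)"
    unfolding energy by (rule half_le)
  \<comment> \<open>The first moment may be infinite. If \<open>V = 0\<close> at the same time, the
    integrand is \<open>0\<close>, in agreement with the convention that infinity times
    \<open>0\<close> is \<open>0\<close> in \<open>ennreal\<close>.\<close>
  also have "\<dots> \<le> (\<integral>\<^sup>+x. ennreal (norm x) * V \<partial>\<nu>)"
    using D_V by (intro nn_integral_mono)
  also have "\<dots> = (\<integral>\<^sup>+x. ennreal (norm x) \<partial>\<nu>) * total_variation (Grad u) UNIV"
    by (simp add: nn_integral_multc V_def)
  finally show ?thesis
    using 1 by blast
qed

end
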